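(* $\mathcal A_{11} = \mathcal A_{12} = \mathcal A_{13}$.
   Context: An $\mathcal I$-zroupoid is an algebra $\langle A,\to,0\rangle$ ($\to$ binary, $0$ constant) satisfying $(x \to y) \to z \approx [(z' \to x) \to (y \to z)']'$ and $0''\approx 0$, where $x' := x \to 0$; $\mathcal I$ is the variety of $\mathcal I$-zroupoids. $\mathcal A_{11}, \mathcal A_{12}, \mathcal A_{13}$ are the subvarieties of $\mathcal I$ defined respectively by (A11) $(x \to y) \to z \approx (x \to z) \to y$; (A12) $(x \to y) \to z \approx (y \to x) \to z$; (A13) $(x \to y) \to z \approx (y \to z) \to x$. *)

theory Defs
  imports Main
begin

record 'a alg =
  univ :: "'a set"
  arrow :: "'a \<Rightarrow> 'a \<Rightarrow> 'a"  (infixr \<open>\<rightarrow>\<index>\<close> 60)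
  nul :: 'a  (\<open>\<zero>\<index>\<close>)

definition neg :: "('a, 'b) alg_scheme \<Rightarrow> 'a \<Rightarrow> 'a"  (\<open>\<sim>\<index> _\<close> [81] 80)
  where "\<sim>\<^bsub>A\<^esub> x = x \<rightarrow>\<^bsub>A\<^esub> \<zero>\<^bsub>A\<^esub>"

locale zroupoid_alg =
  fixes A :: "'a alg" (structure)
  assumes arrow_closed: "\<lbrakk>x \<in> univ A; y \<in> univ A\<rbrakk> \<Longrightarrow> x \<rightarrow> y \<in> univ A"
    and nul_closed: "\<zero> \<in> univ A"

locale I_zroupoid = zroupoid_alg +
  assumes I_identity:
      "\<lbrakk>x \<in> univ A; y \<in> univ A; z \<in> univ A\<rbrakk> \<Longrightarrow>
        (x \<rightarrow> y) \<rightarrow> z = \<sim> ((\<sim> z \<rightarrow> x) \<rightarrow> \<sim> (y \<rightarrow> z))"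
    and nul_neg_neg: "\<sim> (\<sim> \<zero>) = \<zero>"

text \<open>
  A variety is a proper class of algebras. In HOL it is rendered by its members whose universe
  is a subset of a type \<open>'a\<close>; as \<open>'a\<close> is arbitrary, an equation between varieties that is
  polymorphic in \<open>'a\<close> is an equation between the classes.
\<close>

definition var_I :: "'a alg set"
  where "var_I = {A. I_zroupoid A}"

definition var_A11 :: "'a alg set"
  where "var_A11 = {A \<in> var_I. \<forall>x\<in>univ A. \<forall>y\<in>univ A. \<forall>z\<in>univ A.
    (x \<rightarrow>\<^bsub>A\<^esub> y) \<rightarrow>\<^bsub>A\<^esub> z = (x \<rightarrow>\<^bsub>A\<^esub> z) \<rightarrow>\<^bsub>A\<^esub> y}"

definition var_A12 :: "'a alg set"
  where "var_A12 = {A \<in> var_I. \<forall>x\<in>univ A. \<forall>y\<in>univ A. \<forall>z\<in>univ A.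
    (x \<rightarrow>\<^bsub>A\<^esub> y) \<rightarrow>\<^bsub>A\<^esub> z = (y \<rightarrow>\<^bsub>A\<^esub> x) \<rightarrow>\<^bsub>A\<^esub> z}"

definition var_A13 :: "'a alg set"
  where "var_A13 = {A \<in> var_I. \<forall>x\<in>univ A. \<forall>y\<in>univ A. \<forall>z\<in>univ A.
    (x \<rightarrow>\<^bsub>A\<^esub> y) \<rightarrow>\<^bsub>A\<^esub> z = (y \<rightarrow>\<^bsub>A\<^esub> z) \<rightarrow>\<^bsub>A\<^esub> x}"

end

theory Submission
  imports Defs
begin

text \<open>
  All terms in the identities involved are compound, so extending the operation of an algebra
  from its universe to the whole type by sending outside elements to \<open>\<zero>\<close> preserves
  these identities and removes the membership conditions. For the total operation, (A11) implies
  (A12), and (A12) and (A13) imply each other. Conversely, (A12) and (A13) permute the three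
  arguments by a transposition and a 3-cycle, which together generate (A11).
  The crucial step from (A12) to (A13) is to absorb negations under a negation, giving
  \<open>(x \<rightarrow> y')' = (x \<rightarrow> y)'\<close>, which reduces the defining identity to
  \<open>(x \<rightarrow> y) \<rightarrow> z = ((z \<rightarrow> x) \<rightarrow> (y \<rightarrow> z))'\<close>.
\<close>

locale total_I_zroupoid =
  fixes imp :: "'a \<Rightarrow> 'a \<Rightarrow> 'a"  (infixr \<open>\<leadsto>\<close> 60)
    and z0 :: 'a
  assumes I_law: "(x \<leadsto> y) \<leadsto> z = (((z \<leadsto> z0) \<leadsto> x) \<leadsto> (y \<leadsto> z) \<leadsto> z0) \<leadsto> z0"
    and z0_law: "(z0 \<leadsto> z0) \<leadsto> z0 = z0"
begin

lemma A11_imp_A12: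
  assumes "\<And>x y z. (x \<leadsto> y) \<leadsto> z = (x \<leadsto> z) \<leadsto> y"
  shows "(x \<leadsto> y) \<leadsto> z = (y \<leadsto> x) \<leadsto> z"
  by (metis assms z0_law I_law)

lemma A12_imp_A13:
  assumes A: "\<And>x y z. (x \<leadsto> y) \<leadsto> z = (y \<leadsto> x) \<leadsto> z"
  shows "(x \<leadsto> y) \<leadsto> z = (y \<leadsto> z) \<leadsto> x"
proof -
  \<comment> \<open>Write x' for \<open>x \<leadsto> z0\<close> and 0 for \<open>z0\<close>. (A12)
    and \<open>I_law\<close> give 0 \<leadsto> 0' = 0', so 0 \<leadsto> z = (0' \<leadsto> 0)
    \<leadsto> z = (0 \<leadsto> 0') \<leadsto> z = 0' \<leadsto> z; at z = 0 this reads 0' = 0'' =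
    0.\<close>
  have zero: "z0 \<leadsto> z0 = z0"
    by (metis A z0_law I_law)
  have neg_imp: "(x \<leadsto> y) \<leadsto> z0 = ((z0 \<leadsto> x) \<leadsto> (y \<leadsto> z0) \<leadsto> z0) \<leadsto> z0" for x y
    using I_law[of x y z0] by (simp add: zero)
  have "(z0 \<leadsto> z0 \<leadsto> x) \<leadsto> z0 = (x \<leadsto> z0) \<leadsto> z0" for x
    using neg_imp[of x z0] A[of z0 "z0 \<leadsto> x" z0] by (simp add: zero)
  \<comment> \<open>Up to (A12) this says x''' = x''.\<close>
  then have "(z0 \<leadsto> x \<leadsto> z0) \<leadsto> z0 = (x \<leadsto> z0) \<leadsto> z0" for x
    by (metis A)
  \<comment> \<open>By \<open>neg_imp\<close>, (x \<leadsto> w)' depends on w only through w''; x'''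
    = x'' then lets w vary here and in the next two steps.\<close>
  then have "(x \<leadsto> z0 \<leadsto> y \<leadsto> z0) \<leadsto> z0 = (x \<leadsto> y \<leadsto> z0) \<leadsto> z0" for x y
    by (metis neg_imp)
  then have "((z0 \<leadsto> x) \<leadsto> y \<leadsto> z0) \<leadsto> z0 = (x \<leadsto> y) \<leadsto> z0" for x y
    by (metis A neg_imp)
  then have neg_right: "(x \<leadsto> y \<leadsto> z0) \<leadsto> z0 = (x \<leadsto> y) \<leadsto> z0" for x y
    using neg_imp by simp
  have neg_left: "((y \<leadsto> z0) \<leadsto> x) \<leadsto> z0 = (x \<leadsto> y) \<leadsto> z0" for x y
    by (metis A neg_right)
  \<comment> \<open>The inner z' is not directly under a negation: \<open>neg_left\<close> allows z'
    \<leadsto> x to be negated first, then z' becomes z, and the auxiliary negation is dropped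
    again.\<close>
  have I_short: "(x \<leadsto> y) \<leadsto> z = ((z \<leadsto> x) \<leadsto> y \<leadsto> z) \<leadsto> z0" for x y z
    by (metis I_law neg_left neg_right)
  have absorb: "(x \<leadsto> y \<leadsto> x) \<leadsto> z0 = (z0 \<leadsto> y) \<leadsto> x" for x y
    by (metis neg_left I_short)
  \<comment> \<open>Iterating \<open>I_short\<close> and using x''' = x'' shows that each (x
    \<leadsto> y) \<leadsto> z equals its own negation. Hence \<open>absorb\<close> amounts to (x
    \<leadsto> (y \<leadsto> x))' = (x \<leadsto> y)', which collapses the repeated arguments that
    \<open>I_short\<close> produces.\<close>
  show ?thesis
    by (metis I_short neg_left zero absorb)
qed

lemma A13_imp_A12:
  assumes "\<And>x y z. (x \<leadsto> y) \<leadsto> z = (y \<leadsto> z) \<leadsto> x"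
  shows "(x \<leadsto> y) \<leadsto> z = (y \<leadsto> x) \<leadsto> z"
  by (metis assms z0_law I_law)

lemma A11_iff_A12:
  "(\<forall>x y z. (x \<leadsto> y) \<leadsto> z = (x \<leadsto> z) \<leadsto> y) \<longleftrightarrow>
   (\<forall>x y z. (x \<leadsto> y) \<leadsto> z = (y \<leadsto> x) \<leadsto> z)"
proof (intro iffI allI)
  fix x y z
  assume "\<forall>x y z. (x \<leadsto> y) \<leadsto> z = (x \<leadsto> z) \<leadsto> y"
  then show "(x \<leadsto> y) \<leadsto> z = (y \<leadsto> x) \<leadsto> z"
    by (intro A11_imp_A12) blast
next
  fix x y z
  assume A12: "\<forall>x y z. (x \<leadsto> y) \<leadsto> z = (y \<leadsto> x) \<leadsto> z"
  then have "(x \<leadsto> y) \<leadsto> z = (y \<leadsto> x) \<leadsto> z"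
    by blast
  also have "\<dots> = (x \<leadsto> z) \<leadsto> y"
    using A12 by (intro A12_imp_A13) blast
  finally show "(x \<leadsto> y) \<leadsto> z = (x \<leadsto> z) \<leadsto> y" .
qed

lemma A12_iff_A13:
  "(\<forall>x y z. (x \<leadsto> y) \<leadsto> z = (y \<leadsto> x) \<leadsto> z) \<longleftrightarrow>
   (\<forall>x y z. (x \<leadsto> y) \<leadsto> z = (y \<leadsto> z) \<leadsto> x)"
proof (intro iffI allI)
  fix x y z
  assume "\<forall>x y z. (x \<leadsto> y) \<leadsto> z = (y \<leadsto> x) \<leadsto> z"
  then show "(x \<leadsto> y) \<leadsto> z = (y \<leadsto> z) \<leadsto> x"
    by (intro A12_imp_A13) blast
next
  fix x y z
  assume "\<forall>x y z. (x \<leadsto> y) \<leadsto> z = (y \<leadsto> z) \<leadsto> x"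
  then show "(x \<leadsto> y) \<leadsto> z = (y \<leadsto> x) \<leadsto> z"
    by (intro A13_imp_A12) blast
qed

end

context zroupoid_alg
begin

definition retract :: "'a \<Rightarrow> 'a"
  where "retract x = (if x \<in> univ A then x else \<zero>)"

definition total_arrow :: "'a \<Rightarrow> 'a \<Rightarrow> 'a"
  where "total_arrow x y = retract x \<rightarrow> retract y"

lemma retract_closed: "retract x \<in> univ A"
  by (simp add: retract_def nul_closed)

lemma retract_id: "x \<in> univ A \<Longrightarrow> retract x = x"
  by (simp add: retract_def)

lemma total_arrow_eq: "\<lbrakk>x \<in> univ A; y \<in> univ A\<rbrakk> \<Longrightarrow> total_arrow x y = x \<rightarrow> y"
  by (simp add: total_arrow_def retract_id)

text \<open>\<open>retract\<close> maps the type onto the universe. Values of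
  \<open>total_arrow\<close> already lie there, so in nested terms \<open>retract\<close> survives
  only on variables, where this equivalence trades it for a bounded quantifier.\<close>

lemma ball_univ_iff_all: "(\<forall>x\<in>univ A. P x) \<longleftrightarrow> (\<forall>x. P (retract x))"
  by (metis retract_closed retract_id)

lemma A11_total_iff:
  "(\<forall>x\<in>univ A. \<forall>y\<in>univ A. \<forall>z\<in>univ A. (x \<rightarrow> y) \<rightarrow> z = (x \<rightarrow> z) \<rightarrow> y) \<longleftrightarrow>
   (\<forall>x y z. total_arrow (total_arrow x y) z = total_arrow (total_arrow x z) y)"
  unfolding ball_univ_iff_all by (simp add: total_arrow_def retract_id arrow_closed retract_closed)

lemma A12_total_iff:
  "(\<forall>x\<in>univ A. \<forall>y\<in>univ A. \<forall>z\<in>univ A. (x \<rightarrow> y) \<rightarrow> z = (y \<rightarrow> x) \<rightarrow> z) \<longleftrightarrow>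
   (\<forall>x y z. total_arrow (total_arrow x y) z = total_arrow (total_arrow y x) z)"
  unfolding ball_univ_iff_all by (simp add: total_arrow_def retract_id arrow_closed retract_closed)

lemma A13_total_iff:
  "(\<forall>x\<in>univ A. \<forall>y\<in>univ A. \<forall>z\<in>univ A. (x \<rightarrow> y) \<rightarrow> z = (y \<rightarrow> z) \<rightarrow> x) \<longleftrightarrow>
   (\<forall>x y z. total_arrow (total_arrow x y) z = total_arrow (total_arrow y z) x)"
  unfolding ball_univ_iff_all by (simp add: total_arrow_def retract_id arrow_closed retract_closed)

end

lemma (in I_zroupoid) total_I_zroupoid: "total_I_zroupoid total_arrow \<zero>"
proof
  fix x y z
  show "total_arrow (total_arrow x y) z =
    total_arrow (total_arrow (total_arrow (total_arrow z \<zero>) x)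
      (total_arrow (total_arrow y z) \<zero>)) \<zero>"
    using I_identity[OF retract_closed retract_closed retract_closed, of x y z]
    by (simp add: neg_def total_arrow_def retract_id arrow_closed retract_closed nul_closed)
  show "total_arrow (total_arrow \<zero> \<zero>) \<zero> = \<zero>"
    using nul_neg_neg by (simp add: neg_def total_arrow_eq nul_closed arrow_closed)
qed

theorem theorem3p14:
  shows "(var_A11 :: 'a alg set) = var_A12 \<and> (var_A12 :: 'a alg set) = var_A13"
proof -
  have "A \<in> var_A11 \<longleftrightarrow> A \<in> var_A12" "A \<in> var_A12 \<longleftrightarrow> A \<in> var_A13"
    if "A \<in> var_I" for A :: "'a alg"
  proof -
    interpret I_zroupoid A
      using that by (simp add: var_I_def)
    interpret T: total_I_zroupoid total_arrow "\<zero>\<^bsub>A\<^esub>"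
      by (rule total_I_zroupoid)
    show "A \<in> var_A11 \<longleftrightarrow> A \<in> var_A12" "A \<in> var_A12 \<longleftrightarrow> A \<in> var_A13"
      using that A11_total_iff A12_total_iff A13_total_iff T.A11_iff_A12 T.A12_iff_A13
      by (simp_all add: var_A11_def var_A12_def var_A13_def)
  qed
  then show ?thesis
    unfolding var_A11_def var_A12_def var_A13_def by blast
qed

end
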